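(* Let $\mathcal A=(\mathcal A_L,\mathcal A_R,S)$ be a symmetrized Hopf algebroid possessing a non-degenerate left integral, where $\mathcal A_L=(A,L,s_L,t_L,\gamma_L,\pi_L)$ and $\mathcal A_R=(A,R,s_R,t_R,\gamma_R,\pi_R)$. Then the ring extensions $s_R:R\to A$, $t_R:R^{op}\to A$, $s_L:L\to A$ and $t_L:L^{op}\to A$ are all Frobenius extensions.
   Context: All rings are associative and unital. A left bialgebroid $\mathcal A_L=(A,L,s_L,t_L,\gamma_L,\pi_L)$: ring homomorphisms $s_L:L\to A$, $t_L:L^{op}\to A$ with commuting images; $A$ is an $L$-$L$-bimodule via $l\cdot a\cdot l'=s_L(l)t_L(l')a$ (left and right modules ${}_LA$, $A_L$) and a comonoid in $L$-$L$-bimodules via $\gamma_L(a)=a_{(1)}\otimes a_{(2)}\in A_L\otimes{}_LA$, $\pi_L:A\to L$; moreover $a_{(1)}t_L(l)\otimes a_{(2)}=a_{(1)}\otimes a_{(2)}s_L(l)$, $\gamma_L$ is unital and multiplicative, $\pi_L(1)=1$, $\pi_L(as_L(\pi_L(b)))=\pi_L(ab)=\pi_L(at_L(\pi_L(b)))$. A right bialgebroid $\mathcal A_R=(A,R,s_R,t_R,\gamma_R,\pi_R)$: ring homomorphisms $s_R:R\to A$, $t_R:R^{op}\to A$ with commuting images; $A$ is an $R$-$R$-bimodule via $r\cdot a\cdot r'=as_R(r')t_R(r)$ (left and right modules ${}^RA$, $A^R$) and a comonoid in $R$-$R$-bimodules via $\gamma_R(a)=a^{(1)}\otimes a^{(2)}\in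 A^R\otimes{}^RA$, $\pi_R:A\to R$; moreover $s_R(r)a^{(1)}\otimes a^{(2)}=a^{(1)}\otimes t_R(r)a^{(2)}$, $\gamma_R$ is unital and multiplicative, $\pi_R(1)=1$, $\pi_R(s_R(\pi_R(a))b)=\pi_R(ab)=\pi_R(t_R(\pi_R(a))b)$. A symmetrized Hopf algebroid is a triple $(\mathcal A_L,\mathcal A_R,S)$ of a left and a right bialgebroid on the same total ring $A$ with $R\simeq L^{op}$, and a bijection $S:A\to A$ of additive groups, such that: $s_L(L)=t_R(R)$, $t_L(L)=s_R(R)$; $(\gamma_L\otimes\mathrm{id})\gamma_R=(\mathrm{id}\otimes\gamma_R)\gamma_L$, $(\gamma_R\otimes\mathrm{id})\gamma_L=(\mathrm{id}\otimes\gamma_L)\gamma_R$; $S(t_L(l)at_L(l'))=s_L(l')S(a)s_L(l)$, $S(t_R(r')at_R(r))=s_R(r)S(a)s_R(r')$; $S(a_{(1)})a_{(2)}=s_R\pi_R(a)$, $a^{(1)}S(a^{(2)})=s_L\pi_L(a)$. ($S$ is then automatically a ring anti-automorphism.) Let $\mathcal A^*=\mathrm{Hom}(A^R,R^R)$ (right $R$-module maps) and ${}^*\mathcal A=\mathrm{Hom}({}^RA,{}^RR)$ (left $R$-module maps). They act on $A$ by $\phi\rightharpoonup a=a^{(2)}t_R(\phi(a^{(1)}))$ for $\phi\in\mathcal A^*$ and $\phi\rightharpoondown a=a^{(1)}s_R(\phi(a^{(2)}))$ for $\phi\in{}^*\mathcal A$. A left integral is an $\ell\in A$ with $a\ell=s_L(\pi_L(a))\ell$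 for all $a\in A$; it is non-degenerate if both maps $\ell_R:\mathcal A^*\to A$, $\phi\mapsto\phi\rightharpoonup\ell$, and ${}_R\ell:{}^*\mathcal A\to A$, $\phi\mapsto\phi\rightharpoondown\ell$, are bijective. A ring homomorphism $N\to M$ is a Frobenius extension if there is an $N$-$N$-bimodule map $\psi:M\to N$ and an element $\sum_iu_i\otimes v_i\in M\otimes_NM$ with $\sum_i\psi(mu_i)v_i=m=\sum_iu_i\psi(v_im)$ for all $m\in M$. *)

theory Defs
  imports Complex_Main "HOL-Library.Multiset"
begin

text \<open>
  Associative unital rings are types of sort \<open>{ring, monoid_mult}\<close>. This is used in place of
  \<open>ring_1\<close>, whose axiom \<open>0 \<noteq> 1\<close> would exclude the zero ring.
\<close>

definition ring_homomorphism ::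
    "('a::{ring,monoid_mult} \<Rightarrow> 'b::{ring,monoid_mult}) \<Rightarrow> bool" where
  "ring_homomorphism f \<longleftrightarrow>
     additive f \<and> (\<forall>x y. f (x * y) = f x * f y) \<and> f 1 = 1"


section \<open>Opposite rings\<close>

datatype 'a opposite = Op (unop: 'a)

instantiation opposite :: (zero) zero
begin
definition "0 = Op 0"
instance ..
end

instantiation opposite :: (one) one
begin
definition "1 = Op 1"
instance ..
end

instantiation opposite :: (plus) plus
begin
definition "x + y = Op (unop x + unop y)"
instance ..
end

instantiation opposite :: (minus) minus
begin
definition "x - y = Op (unop x - unop y)"
instance ..
end

instantiation opposite :: (uminus) uminus
begin
definition "- x = Op (- unop x)"
instance ..
end

instantiation opposite :: (times) times
begin
definition "x * y = Op (unop y * unop x)"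
instance ..
end

lemmas opposite_simps = zero_opposite_def one_opposite_def plus_opposite_def minus_opposite_def
  uminus_opposite_def times_opposite_def

instance opposite :: (semigroup_mult) semigroup_mult
  by standard (simp_all add: opposite_simps mult.assoc)

instance opposite :: (ring) ring
  by standard (simp_all add: opposite_simps algebra_simps)

instance opposite :: (monoid_mult) monoid_mult
  by standard (simp_all add: opposite_simps)


section \<open>Tensor products over noncommutative rings\<close>

text \<open>
  A formal sum \<open>x\<^sub>1 \<otimes> y\<^sub>1 + \<dots> + x\<^sub>n \<otimes> y\<^sub>n\<close> is a multiset of pairs. The tensor product of a right
  and a left module is the quotient of the free commutative monoid of formal sums by the smallest
  monoid congruence containing the relations of biadditivity and balancedness. Since
  \<open>x \<otimes> 0\<close> and \<open>0 \<otimes> y\<close> are identified with the empty sum, the class of \<open>(-x) \<otimes> y\<close> is inverse to that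
  of \<open>x \<otimes> y\<close>, so the quotient is a group and agrees with the usual quotient of the free abelian
  group.
\<close>

inductive tensor_congruence ::
    "('p multiset \<Rightarrow> 'p multiset \<Rightarrow> bool) \<Rightarrow> 'p multiset \<Rightarrow> 'p multiset \<Rightarrow> bool"
  for G where
  gen: "G X Y \<Longrightarrow> tensor_congruence G X Y"
| refl: "tensor_congruence G X X"
| sym: "tensor_congruence G X Y \<Longrightarrow> tensor_congruence G Y X"
| trans: "tensor_congruence G X Y \<Longrightarrow> tensor_congruence G Y Z \<Longrightarrow> tensor_congruence G X Z"
| add: "tensor_congruence G X Y \<Longrightarrow> tensor_congruence G (X + Z) (Y + Z)"

definition tensor_class ::
    "('p multiset \<Rightarrow> 'p multiset \<Rightarrow> bool) \<Rightarrow> 'p multiset \<Rightarrow> 'p multiset set" where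
  "tensor_class G X = {Y. tensor_congruence G X Y}"

text \<open>Relations for \<open>M \<otimes>\<^sub>N K\<close>, where \<open>ra\<close> is the right action on \<open>M\<close> and \<open>la\<close> the left action on \<open>K\<close>.\<close>

inductive tensor_rel ::
    "('m::ab_group_add \<Rightarrow> 'n \<Rightarrow> 'm) \<Rightarrow> ('n \<Rightarrow> 'k::ab_group_add \<Rightarrow> 'k) \<Rightarrow>
     ('m \<times> 'k) multiset \<Rightarrow> ('m \<times> 'k) multiset \<Rightarrow> bool"
  for ra la where
  "tensor_rel ra la {#(x + x', y)#} {#(x, y), (x', y)#}"
| "tensor_rel ra la {#(x, y + y')#} {#(x, y), (x, y')#}"
| "tensor_rel ra la {#(0, y)#} {#}"
| "tensor_rel ra la {#(x, 0)#} {#}"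
| "tensor_rel ra la {#(ra x n, y)#} {#(x, la n y)#}"

text \<open>Relations for a threefold tensor product \<open>M \<otimes>\<^sub>N K \<otimes>\<^sub>N\<^sub>' P\<close>, without bracketing.\<close>

inductive tensor3_rel ::
    "('m::ab_group_add \<Rightarrow> 'n \<Rightarrow> 'm) \<Rightarrow> ('n \<Rightarrow> 'k::ab_group_add \<Rightarrow> 'k) \<Rightarrow>
     ('k \<Rightarrow> 'n' \<Rightarrow> 'k) \<Rightarrow> ('n' \<Rightarrow> 'p::ab_group_add \<Rightarrow> 'p) \<Rightarrow>
     ('m \<times> 'k \<times> 'p) multiset \<Rightarrow> ('m \<times> 'k \<times> 'p) multiset \<Rightarrow> bool"
  for ra la ra' la' where
  "tensor3_rel ra la ra' la' {#(x + x', y, z)#} {#(x, y, z), (x', y, z)#}"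
| "tensor3_rel ra la ra' la' {#(x, y + y', z)#} {#(x, y, z), (x, y', z)#}"
| "tensor3_rel ra la ra' la' {#(x, y, z + z')#} {#(x, y, z), (x, y, z')#}"
| "tensor3_rel ra la ra' la' {#(0, y, z)#} {#}"
| "tensor3_rel ra la ra' la' {#(x, 0, z)#} {#}"
| "tensor3_rel ra la ra' la' {#(x, y, 0)#} {#}"
| "tensor3_rel ra la ra' la' {#(ra x n, y, z)#} {#(x, la n y, z)#}"
| "tensor3_rel ra la ra' la' {#(x, ra' y n', z)#} {#(x, y, la' n' z)#}"

definition tensors :: "('p multiset \<Rightarrow> 'p multiset \<Rightarrow> bool) \<Rightarrow> 'p multiset set set" where
  "tensors G = range (tensor_class G)"

definition tensor_rep :: "'p multiset set \<Rightarrow> 'p multiset" where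
  "tensor_rep T = (SOME X. X \<in> T)"

text \<open>
  \<open>tensor_eval g T\<close> and \<open>tensor_map G F T\<close> are the images of the tensor \<open>T\<close> under the additive maps
  determined by their values \<open>g p\<close>, respectively the class modulo \<open>G\<close> of \<open>F p\<close>, on elementary
  tensors \<open>p\<close>. They are used below only where these values respect the tensor relations, so that
  the choice of representative does not matter.
\<close>

definition tensor_eval :: "('p \<Rightarrow> 'b::comm_monoid_add) \<Rightarrow> 'p multiset set \<Rightarrow> 'b" where
  "tensor_eval g T = (\<Sum>p\<in>#tensor_rep T. g p)"

definition tensor_map ::
    "('q multiset \<Rightarrow> 'q multiset \<Rightarrow> bool) \<Rightarrow> ('p \<Rightarrow> 'q multiset) \<Rightarrow>
     'p multiset set \<Rightarrow> 'q multiset set" where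
  "tensor_map G F T = tensor_class G (\<Sum>p\<in>#tensor_rep T. F p)"

definition tensor_add ::
    "('p multiset \<Rightarrow> 'p multiset \<Rightarrow> bool) \<Rightarrow>
     'p multiset set \<Rightarrow> 'p multiset set \<Rightarrow> 'p multiset set" where
  "tensor_add G T U = tensor_class G (tensor_rep T + tensor_rep U)"

text \<open>Factorwise product \<open>(x \<otimes> y) (u \<otimes> v) = x u \<otimes> y v\<close>.\<close>

definition tensor_mult ::
    "(('a::times \<times> 'b::times) multiset \<Rightarrow> ('a \<times> 'b) multiset \<Rightarrow> bool) \<Rightarrow>
     ('a \<times> 'b) multiset set \<Rightarrow> ('a \<times> 'b) multiset set \<Rightarrow> ('a \<times> 'b) multiset set" where
  "tensor_mult G T U = tensor_class G
     (\<Sum>(x, y)\<in>#tensor_rep T. \<Sum>(u, v)\<in>#tensor_rep U. {#(x * u, y * v)#})"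

text \<open>The maps \<open>\<gamma> \<otimes> id\<close> and \<open>id \<otimes> \<gamma>\<close>, with values in the threefold tensor product given by \<open>G\<close>.\<close>

definition comult_left ::
    "(('a \<times> 'a \<times> 'a) multiset \<Rightarrow> ('a \<times> 'a \<times> 'a) multiset \<Rightarrow> bool) \<Rightarrow>
     ('a \<Rightarrow> ('a \<times> 'a) multiset set) \<Rightarrow> ('a \<times> 'a) multiset set \<Rightarrow>
     ('a \<times> 'a \<times> 'a) multiset set" where
  "comult_left G \<gamma> =
     tensor_map G (\<lambda>(x, y). image_mset (\<lambda>(u, v). (u, v, y)) (tensor_rep (\<gamma> x)))"

definition comult_right ::
    "(('a \<times> 'a \<times> 'a) multiset \<Rightarrow> ('a \<times> 'a \<times> 'a) multiset \<Rightarrow> bool) \<Rightarrow>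
     ('a \<Rightarrow> ('a \<times> 'a) multiset set) \<Rightarrow> ('a \<times> 'a) multiset set \<Rightarrow>
     ('a \<times> 'a \<times> 'a) multiset set" where
  "comult_right G \<gamma> =
     tensor_map G (\<lambda>(x, y). image_mset (\<lambda>(u, v). (x, u, v)) (tensor_rep (\<gamma> y)))"


section \<open>Frobenius extensions\<close>

text \<open>The tensor product \<open>M \<otimes>\<^sub>N M\<close> along a ring homomorphism \<open>f : N \<rightarrow> M\<close>.\<close>

definition ext_rel ::
    "('n \<Rightarrow> 'm::ring) \<Rightarrow> ('m \<times> 'm) multiset \<Rightarrow> ('m \<times> 'm) multiset \<Rightarrow> bool" where
  "ext_rel f = tensor_rel (\<lambda>m n. m * f n) (\<lambda>n m. f n * m)"

definition frobenius_extension ::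
    "('n::{ring,monoid_mult} \<Rightarrow> 'm::{ring,monoid_mult}) \<Rightarrow> bool" where
  "frobenius_extension f \<longleftrightarrow> ring_homomorphism f \<and>
     (\<exists>\<psi> :: 'm \<Rightarrow> 'n. \<exists>T \<in> tensors (ext_rel f).
        additive \<psi> \<and> (\<forall>n m. \<psi> (f n * m) = n * \<psi> m) \<and> (\<forall>m n. \<psi> (m * f n) = \<psi> m * n) \<and>
        (\<forall>m. tensor_eval (\<lambda>(u, v). f (\<psi> (m * u)) * v) T = m \<and>
             tensor_eval (\<lambda>(u, v). u * f (\<psi> (v * m))) T = m))"


section \<open>Bialgebroids\<close>

text \<open>
  The module structures on the total ring: \<open>l \<cdot> a = s\<^sub>L(l) a\<close> and \<open>a \<cdot> l = t\<^sub>L(l) a\<close> for a left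
  bialgebroid, \<open>r \<cdot> a = a t\<^sub>R(r)\<close> and \<open>a \<cdot> r = a s\<^sub>R(r)\<close> for a right one.
\<close>

definition lactL :: "('l \<Rightarrow> 'a::ring) \<Rightarrow> 'l \<Rightarrow> 'a \<Rightarrow> 'a" where
  "lactL s_L l a = s_L l * a"

definition ractL :: "('l opposite \<Rightarrow> 'a::ring) \<Rightarrow> 'a \<Rightarrow> 'l \<Rightarrow> 'a" where
  "ractL t_L a l = t_L (Op l) * a"

definition lactR :: "('r opposite \<Rightarrow> 'a::ring) \<Rightarrow> 'r \<Rightarrow> 'a \<Rightarrow> 'a" where
  "lactR t_R r a = a * t_R (Op r)"

definition ractR :: "('r \<Rightarrow> 'a::ring) \<Rightarrow> 'a \<Rightarrow> 'r \<Rightarrow> 'a" where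
  "ractR s_R a r = a * s_R r"

text \<open>\<open>A\<^sub>L \<otimes> \<^sub>LA\<close> and \<open>A\<^sup>R \<otimes> \<^sup>RA\<close>\<close>

definition relL ::
    "('l \<Rightarrow> 'a::ring) \<Rightarrow> ('l opposite \<Rightarrow> 'a) \<Rightarrow> ('a \<times> 'a) multiset \<Rightarrow> ('a \<times> 'a) multiset \<Rightarrow> bool"
  where "relL s_L t_L = tensor_rel (ractL t_L) (lactL s_L)"

definition relR ::
    "('r \<Rightarrow> 'a::ring) \<Rightarrow> ('r opposite \<Rightarrow> 'a) \<Rightarrow> ('a \<times> 'a) multiset \<Rightarrow> ('a \<times> 'a) multiset \<Rightarrow> bool"
  where "relR s_R t_R = tensor_rel (ractR s_R) (lactR t_R)"

locale left_bialgebroid =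
  fixes s_L :: "'l::{ring,monoid_mult} \<Rightarrow> 'a::{ring,monoid_mult}"
    and t_L :: "'l opposite \<Rightarrow> 'a"
    and \<gamma>_L :: "'a \<Rightarrow> ('a \<times> 'a) multiset set"
    and \<pi>_L :: "'a \<Rightarrow> 'l"
  assumes sL_hom: "ring_homomorphism s_L"
    and tL_hom: "ring_homomorphism t_L"
    and sL_tL_commute: "s_L l * t_L (Op l') = t_L (Op l') * s_L l"
    \<comment> \<open>comonoid in \<open>L\<close>-\<open>L\<close>-bimodules\<close>
    and \<gamma>L_tensor: "\<gamma>_L a \<in> tensors (relL s_L t_L)"
    and \<gamma>L_add: "\<gamma>_L (a + b) = tensor_add (relL s_L t_L) (\<gamma>_L a) (\<gamma>_L b)"
    and \<gamma>L_bimodule: "\<gamma>_L (s_L l * t_L (Op l') * a) =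
      tensor_map (relL s_L t_L) (\<lambda>(x, y). {#(s_L l * x, t_L (Op l') * y)#}) (\<gamma>_L a)"
    and \<pi>L_add: "additive \<pi>_L"
    and \<pi>L_bimodule: "\<pi>_L (s_L l * t_L (Op l') * a) = l * \<pi>_L a * l'"
    and \<gamma>L_coassoc:
      "comult_left (tensor3_rel (ractL t_L) (lactL s_L) (ractL t_L) (lactL s_L)) \<gamma>_L (\<gamma>_L a) =
       comult_right (tensor3_rel (ractL t_L) (lactL s_L) (ractL t_L) (lactL s_L)) \<gamma>_L (\<gamma>_L a)"
    and \<gamma>L_counit_left: "tensor_eval (\<lambda>(x, y). lactL s_L (\<pi>_L x) y) (\<gamma>_L a) = a"
    and \<gamma>L_counit_right: "tensor_eval (\<lambda>(x, y). ractL t_L x (\<pi>_L y)) (\<gamma>_L a) = a"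
    \<comment> \<open>compatibility with the ring structure\<close>
    and \<gamma>L_takeuchi:
      "tensor_map (relL s_L t_L) (\<lambda>(x, y). {#(x * t_L (Op l), y)#}) (\<gamma>_L a) =
       tensor_map (relL s_L t_L) (\<lambda>(x, y). {#(x, y * s_L l)#}) (\<gamma>_L a)"
    and \<gamma>L_one: "\<gamma>_L 1 = tensor_class (relL s_L t_L) {#(1, 1)#}"
    and \<gamma>L_mult: "\<gamma>_L (a * b) = tensor_mult (relL s_L t_L) (\<gamma>_L a) (\<gamma>_L b)"
    and \<pi>L_one: "\<pi>_L 1 = 1"
    and \<pi>L_sL: "\<pi>_L (a * s_L (\<pi>_L b)) = \<pi>_L (a * b)"
    and \<pi>L_tL: "\<pi>_L (a * t_L (Op (\<pi>_L b))) = \<pi>_L (a * b)"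

locale right_bialgebroid =
  fixes s_R :: "'r::{ring,monoid_mult} \<Rightarrow> 'a::{ring,monoid_mult}"
    and t_R :: "'r opposite \<Rightarrow> 'a"
    and \<gamma>_R :: "'a \<Rightarrow> ('a \<times> 'a) multiset set"
    and \<pi>_R :: "'a \<Rightarrow> 'r"
  assumes sR_hom: "ring_homomorphism s_R"
    and tR_hom: "ring_homomorphism t_R"
    and sR_tR_commute: "s_R r * t_R (Op r') = t_R (Op r') * s_R r"
    \<comment> \<open>comonoid in \<open>R\<close>-\<open>R\<close>-bimodules\<close>
    and \<gamma>R_tensor: "\<gamma>_R a \<in> tensors (relR s_R t_R)"
    and \<gamma>R_add: "\<gamma>_R (a + b) = tensor_add (relR s_R t_R) (\<gamma>_R a) (\<gamma>_R b)"
    and \<gamma>R_bimodule: "\<gamma>_R (a * s_R r' * t_R (Op r)) =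
      tensor_map (relR s_R t_R) (\<lambda>(x, y). {#(x * t_R (Op r), y * s_R r')#}) (\<gamma>_R a)"
    and \<pi>R_add: "additive \<pi>_R"
    and \<pi>R_bimodule: "\<pi>_R (a * s_R r' * t_R (Op r)) = r * \<pi>_R a * r'"
    and \<gamma>R_coassoc:
      "comult_left (tensor3_rel (ractR s_R) (lactR t_R) (ractR s_R) (lactR t_R)) \<gamma>_R (\<gamma>_R a) =
       comult_right (tensor3_rel (ractR s_R) (lactR t_R) (ractR s_R) (lactR t_R)) \<gamma>_R (\<gamma>_R a)"
    and \<gamma>R_counit_left: "tensor_eval (\<lambda>(x, y). lactR t_R (\<pi>_R x) y) (\<gamma>_R a) = a"
    and \<gamma>R_counit_right: "tensor_eval (\<lambda>(x, y). ractR s_R x (\<pi>_R y)) (\<gamma>_R a) = a"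
    \<comment> \<open>compatibility with the ring structure\<close>
    and \<gamma>R_takeuchi:
      "tensor_map (relR s_R t_R) (\<lambda>(x, y). {#(s_R r * x, y)#}) (\<gamma>_R a) =
       tensor_map (relR s_R t_R) (\<lambda>(x, y). {#(x, t_R (Op r) * y)#}) (\<gamma>_R a)"
    and \<gamma>R_one: "\<gamma>_R 1 = tensor_class (relR s_R t_R) {#(1, 1)#}"
    and \<gamma>R_mult: "\<gamma>_R (a * b) = tensor_mult (relR s_R t_R) (\<gamma>_R a) (\<gamma>_R b)"
    and \<pi>R_one: "\<pi>_R 1 = 1"
    and \<pi>R_sR: "\<pi>_R (s_R (\<pi>_R a) * b) = \<pi>_R (a * b)"
    and \<pi>R_tR: "\<pi>_R (t_R (Op (\<pi>_R a)) * b) = \<pi>_R (a * b)"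


section \<open>Symmetrized Hopf algebroids\<close>

locale symmetrized_hopf_algebroid =
  left_bialgebroid s_L t_L \<gamma>_L \<pi>_L + right_bialgebroid s_R t_R \<gamma>_R \<pi>_R
  for s_L :: "'l::{ring,monoid_mult} \<Rightarrow> 'a::{ring,monoid_mult}"
    and t_L :: "'l opposite \<Rightarrow> 'a"
    and \<gamma>_L :: "'a \<Rightarrow> ('a \<times> 'a) multiset set"
    and \<pi>_L :: "'a \<Rightarrow> 'l"
    and s_R :: "'r::{ring,monoid_mult} \<Rightarrow> 'a"
    and t_R :: "'r opposite \<Rightarrow> 'a"
    and \<gamma>_R :: "'a \<Rightarrow> ('a \<times> 'a) multiset set"
    and \<pi>_R :: "'a \<Rightarrow> 'r" +
  fixes S :: "'a \<Rightarrow> 'a"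
  assumes base_iso: "\<exists>\<theta> :: 'r \<Rightarrow> 'l opposite. ring_homomorphism \<theta> \<and> bij \<theta>"
    and S_add: "additive S"
    and S_bij: "bij S"
    and range_sL: "range s_L = range t_R"
    and range_tL: "range t_L = range s_R"
    \<comment> \<open>equalities in \<open>A\<^sub>L \<otimes> \<^sub>LA\<^sup>R \<otimes> \<^sup>RA\<close> and in \<open>A\<^sup>R \<otimes> \<^sup>RA\<^sub>L \<otimes> \<^sub>LA\<close>\<close>
    and coassoc_LR:
      "comult_left (tensor3_rel (ractL t_L) (lactL s_L) (ractR s_R) (lactR t_R)) \<gamma>_L (\<gamma>_R a) =
       comult_right (tensor3_rel (ractL t_L) (lactL s_L) (ractR s_R) (lactR t_R)) \<gamma>_R (\<gamma>_L a)"
    and coassoc_RL: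
      "comult_left (tensor3_rel (ractR s_R) (lactR t_R) (ractL t_L) (lactL s_L)) \<gamma>_R (\<gamma>_L a) =
       comult_right (tensor3_rel (ractR s_R) (lactR t_R) (ractL t_L) (lactL s_L)) \<gamma>_L (\<gamma>_R a)"
    and S_L: "S (t_L (Op l) * a * t_L (Op l')) = s_L l' * S a * s_L l"
    and S_R: "S (t_R (Op r') * a * t_R (Op r)) = s_R r * S a * s_R r'"
    and antipode_left: "tensor_eval (\<lambda>(x, y). S x * y) (\<gamma>_L a) = s_R (\<pi>_R a)"
    and antipode_right: "tensor_eval (\<lambda>(x, y). x * S y) (\<gamma>_R a) = s_L (\<pi>_L a)"


section \<open>Dual modules and integrals\<close>

text \<open>\<open>Hom(A\<^sup>R, R\<^sup>R)\<close> and \<open>Hom(\<^sup>RA, \<^sup>RR)\<close>\<close>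

definition right_dual ::
    "('r::{ring,monoid_mult} \<Rightarrow> 'a::{ring,monoid_mult}) \<Rightarrow> ('a \<Rightarrow> 'r) set" where
  "right_dual s_R = {\<phi>. additive \<phi> \<and> (\<forall>a r. \<phi> (ractR s_R a r) = \<phi> a * r)}"

definition left_dual ::
    "('r::{ring,monoid_mult} opposite \<Rightarrow> 'a::{ring,monoid_mult}) \<Rightarrow> ('a \<Rightarrow> 'r) set" where
  "left_dual t_R = {\<phi>. additive \<phi> \<and> (\<forall>r a. \<phi> (lactR t_R r a) = r * \<phi> a)}"

definition right_dual_action ::
    "('r opposite \<Rightarrow> 'a::{ring,monoid_mult}) \<Rightarrow> ('a \<Rightarrow> ('a \<times> 'a) multiset set) \<Rightarrow>
     ('a \<Rightarrow> 'r) \<Rightarrow> 'a \<Rightarrow> 'a" where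
  "right_dual_action t_R \<gamma>_R \<phi> a = tensor_eval (\<lambda>(x, y). y * t_R (Op (\<phi> x))) (\<gamma>_R a)"

definition left_dual_action ::
    "('r \<Rightarrow> 'a::{ring,monoid_mult}) \<Rightarrow> ('a \<Rightarrow> ('a \<times> 'a) multiset set) \<Rightarrow>
     ('a \<Rightarrow> 'r) \<Rightarrow> 'a \<Rightarrow> 'a" where
  "left_dual_action s_R \<gamma>_R \<phi> a = tensor_eval (\<lambda>(x, y). x * s_R (\<phi> y)) (\<gamma>_R a)"

definition left_integral ::
    "('l \<Rightarrow> 'a::{ring,monoid_mult}) \<Rightarrow> ('a \<Rightarrow> 'l) \<Rightarrow> 'a \<Rightarrow> bool" where
  "left_integral s_L \<pi>_L i \<longleftrightarrow> (\<forall>a. a * i = s_L (\<pi>_L a) * i)"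

definition nondegenerate ::
    "('r::{ring,monoid_mult} \<Rightarrow> 'a::{ring,monoid_mult}) \<Rightarrow> ('r opposite \<Rightarrow> 'a) \<Rightarrow>
     ('a \<Rightarrow> ('a \<times> 'a) multiset set) \<Rightarrow> 'a \<Rightarrow> bool" where
  "nondegenerate s_R t_R \<gamma>_R i \<longleftrightarrow>
     bij_betw (\<lambda>\<phi>. right_dual_action t_R \<gamma>_R \<phi> i) (right_dual s_R) UNIV \<and>
     bij_betw (\<lambda>\<phi>. left_dual_action s_R \<gamma>_R \<phi> i) (left_dual t_R) UNIV"

end

theory Submission
  imports Defs
begin

text \<open>
  By non-degeneracy there are \<open>\<phi> \<in> A\<^sup>*\<close> and \<open>\<mu> \<in> \<^sup>*A\<close> with \<open>\<phi> \<rightharpoonup> i = 1 = \<mu> \<rightharpoondown> i\<close>. Computing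
  \<open>i\<^sup>(\<^sup>1\<^sup>) \<otimes> a i\<^sup>(\<^sup>2\<^sup>) = S(a) i\<^sup>(\<^sup>1\<^sup>) \<otimes> i\<^sup>(\<^sup>2\<^sup>)\<close> from mixed coassociativity and the integral property, one gets
  \<open>\<phi> \<circ> S = \<mu>\<close>, and then \<open>(\<phi>, i\<^sup>(\<^sup>1\<^sup>) \<otimes> S(i\<^sup>(\<^sup>2\<^sup>)))\<close> is a Frobenius system for \<open>s\<^sub>R\<close> and
  \<open>(\<mu>, i\<^sup>(\<^sup>2\<^sup>) \<otimes> S\<inverse>(i\<^sup>(\<^sup>1\<^sup>)))\<close> one for \<open>t\<^sub>R\<close>. Both use that \<open>S\<close> is antimultiplicative. Finally
  \<open>s\<^sub>L\<close> and \<open>t\<^sub>L\<close> differ from \<open>t\<^sub>R\<close> and \<open>s\<^sub>R\<close> by ring isomorphisms of the bases.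

  Identities between tensors are tested against balanced maps, so that only sums over
  representatives occur.
\<close>


section \<open>Evaluation of tensors\<close>

text \<open>The additive extension of \<open>h\<close> to formal sums identifies both sides of every
  generating relation. This is what makes \<open>tensor_eval h\<close> independent of the
  representative picked by \<open>tensor_rep\<close>.\<close>

definition compatible ::
    "('p multiset \<Rightarrow> 'p multiset \<Rightarrow> bool) \<Rightarrow> ('p \<Rightarrow> 'b::comm_monoid_add) \<Rightarrow> bool" where
  "compatible G h \<longleftrightarrow> (\<forall>X Y. G X Y \<longrightarrow> (\<Sum>p\<in>#X. h p) = (\<Sum>p\<in>#Y. h p))"

lemma sum_mset_congruence:
  assumes "tensor_congruence G X Y" "compatible G h"
  shows "(\<Sum>p\<in>#X. h p) = (\<Sum>p\<in>#Y. h p)"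
  using assms by induction (auto simp: compatible_def)

lemma tensor_eval_class:
  assumes "compatible G h"
  shows "tensor_eval h (tensor_class G X) = (\<Sum>p\<in>#X. h p)"
proof -
  have "X \<in> tensor_class G X"
    by (simp add: tensor_class_def tensor_congruence.refl)
  then have "tensor_rep (tensor_class G X) \<in> tensor_class G X"
    unfolding tensor_rep_def by (rule someI)
  then show ?thesis
    using sum_mset_congruence[OF _ assms] by (simp add: tensor_class_def tensor_eval_def)
qed

lemma sum_mset_sum_mset:
  fixes h :: "'b \<Rightarrow> 'c::comm_monoid_add"
  shows "(\<Sum>q\<in>#(\<Sum>p\<in>#X. F p). h q) = (\<Sum>p\<in>#X. \<Sum>q\<in>#F p. h q)"
  by (induction X) auto

text \<open>Both sides sum over the same \<open>tensor_rep T\<close>, so the only choice to be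
  controlled is the representative of the class modulo \<open>G\<close>.\<close>

lemma tensor_eval_map:
  assumes "compatible G h"
  shows "tensor_eval h (tensor_map G F T) = tensor_eval (\<lambda>p. \<Sum>q\<in>#F p. h q) T"
  unfolding tensor_map_def tensor_eval_class[OF assms] sum_mset_sum_mset
  by (simp add: tensor_eval_def)

lemma tensor_eval_comult_left:
  assumes "compatible G h"
  shows "tensor_eval h (comult_left G \<gamma> T) =
    tensor_eval (\<lambda>(x, y). tensor_eval (\<lambda>(u, v). h (u, v, y)) (\<gamma> x)) T"
  unfolding comult_left_def tensor_eval_map[OF assms]
  by (simp add: tensor_eval_def split_def image_mset.compositionality comp_def)

lemma tensor_eval_comult_right:
  assumes "compatible G h"
  shows "tensor_eval h (comult_right G \<gamma> T) =
    tensor_eval (\<lambda>(x, y). tensor_eval (\<lambda>(u, v). h (x, u, v)) (\<gamma> y)) T"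
  unfolding comult_right_def tensor_eval_map[OF assms]
  by (simp add: tensor_eval_def split_def image_mset.compositionality comp_def)

lemma tensor_eval_mult:
  assumes "compatible G h"
  shows "tensor_eval h (tensor_mult G T U) =
    tensor_eval (\<lambda>(x, y). tensor_eval (\<lambda>(u, v). h (x * u, y * v)) U) T"
  unfolding tensor_mult_def tensor_eval_class[OF assms]
  \<comment> \<open>The inner sums stay sums of singletons, so that \<open>sum_mset_sum_mset\<close>
    applies at both levels.\<close>
  by (simp add: tensor_eval_def sum_mset_sum_mset split_def del: sum_mset_singleton_mset)

lemma additive_sum_mset:
  assumes "additive f"
  shows "f (\<Sum>p\<in>#X. g p) = (\<Sum>p\<in>#X. f (g p))"
  by (induction X) (simp_all add: additive.zero[OF assms] additive.add[OF assms])

lemma additive_tensor_eval: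
  assumes "additive f"
  shows "f (tensor_eval g T) = tensor_eval (\<lambda>p. f (g p)) T"
  unfolding tensor_eval_def by (rule additive_sum_mset[OF assms])

lemma additive_tensor_eval2:
  assumes "additive f"
  shows "f (tensor_eval (\<lambda>(x, y). g x y) T) = tensor_eval (\<lambda>(x, y). f (g x y)) T"
  unfolding additive_tensor_eval[OF assms] by (simp add: split_def)

lemma tensor_eval_swap:
  "tensor_eval (\<lambda>(x, y). tensor_eval (\<lambda>(u, v). h x y u v) U) T =
   tensor_eval (\<lambda>(u, v). tensor_eval (\<lambda>(x, y). h x y u v) T) U"
  unfolding tensor_eval_def split_def by (rule sum_mset.swap)

lemma tensor_eval_add:
  "tensor_eval (\<lambda>(x, y). g x y + h x y) T =
   tensor_eval (\<lambda>(x, y). g x y) T + tensor_eval (\<lambda>(x, y). h x y) T"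
  unfolding tensor_eval_def split_def by (rule sum_mset.distrib)

lemma additive_mult_left: "additive (\<lambda>x::'a::ring. c * x)"
  by (simp add: additive_def distrib_left)

lemma additive_mult_right: "additive (\<lambda>x::'a::ring. x * c)"
  by (simp add: additive_def distrib_right)

lemmas mult_tensor_eval = additive_tensor_eval2[OF additive_mult_left]
lemmas tensor_eval_mult_right = additive_tensor_eval2[OF additive_mult_right]

text \<open>These are the maps that factor through the tensor product given by
  \<open>tensor_rel ra la\<close>. The target is a group, so additivity already forces the value 0
  on a zero factor.\<close>

definition balanced ::
    "('m::ab_group_add \<Rightarrow> 'n \<Rightarrow> 'm) \<Rightarrow> ('n \<Rightarrow> 'k::ab_group_add \<Rightarrow> 'k) \<Rightarrow>
     ('m \<Rightarrow> 'k \<Rightarrow> 'b::ab_group_add) \<Rightarrow> bool" where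
  "balanced ra la h \<longleftrightarrow> (\<forall>y. additive (\<lambda>x. h x y)) \<and> (\<forall>x. additive (h x)) \<and>
     (\<forall>x n y. h (ra x n) y = h x (la n y))"

lemma compatible_tensor_rel:
  assumes "balanced ra la h"
  shows "compatible (tensor_rel ra la) (\<lambda>(x, y). h x y)"
proof -
  have l: "additive (\<lambda>x. h x y)" and r: "additive (h x)" for x y
    using assms by (auto simp: balanced_def)
  have [simp]: "h (ra x n) y = h x (la n y)" for x y n
    using assms by (auto simp: balanced_def)
  note [simp] = additive.add[OF l] additive.add[OF r] additive.zero[OF l] additive.zero[OF r]
  show ?thesis
    unfolding compatible_def by (auto elim!: tensor_rel.cases simp: add.commute)
qed

lemma additive_tensor_evalI:
  assumes "\<And>u v. additive (\<lambda>x. h x u v)"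
  shows "additive (\<lambda>x. tensor_eval (\<lambda>(u, v). h x u v) T)"
  unfolding additive_def tensor_eval_add[symmetric]
proof (intro allI)
  fix x y
  have "h (x + y) u v = h x u v + h y u v" for u v
    by (rule additive.add[OF assms])
  then show "tensor_eval (\<lambda>(u, v). h (x + y) u v) T = tensor_eval (\<lambda>(u, v). h x u v + h y u v) T"
    by simp
qed

lemma compatible_tensor3_rel:
  assumes l: "\<And>y z. additive (\<lambda>x. h x y z)" and m: "\<And>x z. additive (\<lambda>y. h x y z)"
    and r: "\<And>x y. additive (\<lambda>z. h x y z)"
    and "\<And>x y z n. h (ra x n) y z = h x (la n y) z"
    and "\<And>x y z n. h x (ra' y n) z = h x y (la' n z)"
  shows "compatible (tensor3_rel ra la ra' la') (\<lambda>(x, y, z). h x y z)"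
proof -
  note [simp] = assms(4,5) additive.add[OF l] additive.add[OF m] additive.add[OF r]
    additive.zero[OF l] additive.zero[OF m] additive.zero[OF r]
  show ?thesis
    unfolding compatible_def by (auto elim!: tensor3_rel.cases simp: add.commute)
qed


section \<open>Frobenius extensions\<close>

text \<open>Right linearity of \<open>\<psi>\<close> makes the first evaluation balanced over
  \<open>f\<close>, left linearity the second. Hence both identities may be checked on a formal sum
  \<open>X\<close> instead of the chosen representative of its class.\<close>

lemma frobenius_extensionI:
  assumes "ring_homomorphism f" "additive \<psi>"
    and lin: "\<And>n m. \<psi> (f n * m) = n * \<psi> m" "\<And>m n. \<psi> (m * f n) = \<psi> m * n"
    and "\<And>m. (\<Sum>(u, v)\<in>#X. f (\<psi> (m * u)) * v) = m"
    and "\<And>m. (\<Sum>(u, v)\<in>#X. u * f (\<psi> (v * m))) = m"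
  shows "frobenius_extension f"
proof -
  have f: "additive f" and f_mult: "f (x * y) = f x * f y" for x y
    using assms(1) by (auto simp: ring_homomorphism_def)
  note [simp] = additive.add[OF f] additive.add[OF \<open>additive \<psi>\<close>] lin f_mult
  have "compatible (ext_rel f) (\<lambda>(u, v). f (\<psi> (m * u)) * v)" for m
    unfolding ext_rel_def
    by (rule compatible_tensor_rel)
      (simp add: balanced_def additive_def algebra_simps flip: mult.assoc)
  moreover have "compatible (ext_rel f) (\<lambda>(u, v). u * f (\<psi> (v * m)))" for m
    unfolding ext_rel_def
    by (rule compatible_tensor_rel) (simp add: balanced_def additive_def algebra_simps)
  ultimately show ?thesis
    unfolding frobenius_extension_def using assms
    by (intro conjI exI[of _ \<psi>] bexI[of _ "tensor_class (ext_rel f) X"])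
      (simp_all add: tensor_eval_class tensors_def)
qed

text \<open>The base ring enters the relations only through the elements \<open>f n\<close>.\<close>

lemma ext_rel_mono:
  assumes "range f \<subseteq> range g"
  shows "ext_rel f \<le> ext_rel g"
proof (intro predicate2I)
  fix X Y
  assume "ext_rel f X Y"
  then show "ext_rel g X Y"
    unfolding ext_rel_def
  proof cases
    case (5 x n y)
    obtain k where "f n = g k" using assms by blast
    then show "tensor_rel (\<lambda>m n. m * g n) (\<lambda>n m. g n * m) X Y"
      using 5 tensor_rel.intros(5)[of "\<lambda>m n. m * g n" "\<lambda>n m. g n * m"] by simp
  qed (auto intro: tensor_rel.intros)
qed

text \<open>Equal ranges give the same tensor product, so \<open>T\<close> can be kept; the
  functional becomes \<open>inv f \<circ> g \<circ> \<psi>\<close>. Identities in the domain of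
  \<open>f\<close> are checked after applying the injective \<open>f\<close>.\<close>

lemma frobenius_extension_cong_range:
  assumes f: "ring_homomorphism f" "inj f" and g: "frobenius_extension g"
    and range: "range f = range g"
  shows "frobenius_extension f"
proof -
  obtain \<psi> T where T: "T \<in> tensors (ext_rel g)" and \<psi>: "additive \<psi>"
    and lin: "\<And>n m. \<psi> (g n * m) = n * \<psi> m" "\<And>m n. \<psi> (m * g n) = \<psi> m * n"
    and eq: "\<And>m. tensor_eval (\<lambda>(u, v). g (\<psi> (m * u)) * v) T = m"
      "\<And>m. tensor_eval (\<lambda>(u, v). u * g (\<psi> (v * m))) T = m"
    using g unfolding frobenius_extension_def by blast
  have g_hom: "ring_homomorphism g"
    using g by (simp add: frobenius_extension_def)
  define \<psi>' where "\<psi>' m = inv f (g (\<psi> m))" for m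
  have f\<psi>': "f (\<psi>' m) = g (\<psi> m)" for m
    unfolding \<psi>'_def using range by (metis f_inv_into_f rangeI)
  have f_add: "f (x + y) = f x + f y" and f_mult: "f (x * y) = f x * f y" for x y
    using f(1) by (auto simp: ring_homomorphism_def additive_def)
  have g_add: "g (x + y) = g x + g y" and g_mult: "g (x * y) = g x * g y" for x y
    using g_hom by (auto simp: ring_homomorphism_def additive_def)
  have "ext_rel f = ext_rel g"
    using range by (intro antisym ext_rel_mono) auto
  moreover have "additive \<psi>'"
    unfolding additive_def
    by (intro allI injD[OF f(2)]) (simp add: f\<psi>' f_add g_add additive.add[OF \<psi>])
  moreover have "\<psi>' (f n * m) = n * \<psi>' m" for n m
  proof (rule injD[OF f(2)])
    obtain k where k: "f n = g k" using range by (metis rangeI imageE)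
    show "f (\<psi>' (f n * m)) = f (n * \<psi>' m)"
      by (simp add: f\<psi>' f_mult k lin g_mult)
  qed
  moreover have "\<psi>' (m * f n) = \<psi>' m * n" for n m
  proof (rule injD[OF f(2)])
    obtain k where k: "f n = g k" using range by (metis rangeI imageE)
    show "f (\<psi>' (m * f n)) = f (\<psi>' m * n)"
      by (simp add: f\<psi>' f_mult k lin g_mult)
  qed
  ultimately show ?thesis
    unfolding frobenius_extension_def using f(1) T eq
    by (intro conjI exI[of _ \<psi>'] bexI[of _ T]) (simp_all add: f\<psi>')
qed


section \<open>Bialgebroids\<close>

context left_bialgebroid
begin

lemma sL_one: "s_L 1 = 1" and tL_one: "t_L 1 = 1"
  using sL_hom tL_hom by (auto simp: ring_homomorphism_def)

text \<open>The counit retracts both base maps of the left bialgebroid. Injectivity is needed to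
  transport Frobenius systems from \<open>t_R\<close> and \<open>s_R\<close> to \<open>s_L\<close>
  and \<open>t_L\<close>.\<close>

lemma inj_sL: "inj s_L"
proof (rule inj_on_inverseI)
  show "\<pi>_L (s_L x) = x" for x
    using \<pi>L_bimodule[of x 1 1] by (simp add: \<pi>L_one tL_one flip: one_opposite_def)
qed

lemma inj_tL: "inj t_L"
proof (rule inj_on_inverseI)
  show "Op (\<pi>_L (t_L x)) = x" for x
    using \<pi>L_bimodule[of 1 "unop x" 1] by (simp add: \<pi>L_one sL_one)
qed

lemma eval_\<gamma>L_takeuchi:
  assumes "balanced (ractL t_L) (lactL s_L) h"
  shows "tensor_eval (\<lambda>(x, y). h (x * t_L (Op l)) y) (\<gamma>_L a) =
    tensor_eval (\<lambda>(x, y). h x (y * s_L l)) (\<gamma>_L a)"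
  using arg_cong[OF \<gamma>L_takeuchi, of "tensor_eval (\<lambda>(x, y). h x y)" l a]
    compatible_tensor_rel[OF assms]
  by (simp add: tensor_eval_map relL_def split_def)

lemma eval_\<gamma>L_mult:
  assumes "balanced (ractL t_L) (lactL s_L) h"
  shows "tensor_eval (\<lambda>(x, y). h x y) (\<gamma>_L (a * b)) =
    tensor_eval (\<lambda>(x, y). tensor_eval (\<lambda>(u, v). h (x * u) (y * v)) (\<gamma>_L b)) (\<gamma>_L a)"
  using compatible_tensor_rel[OF assms] unfolding \<gamma>L_mult relL_def
  by (simp add: tensor_eval_mult)

text \<open>Factorwise multiplication by \<open>\<gamma>_L a\<close> from the left respects the
  tensor relations: the Takeuchi condition trades \<open>t_L (Op l)\<close> to the right of
  \<open>u\<close> for \<open>s_L l\<close> to the right of \<open>v\<close>.\<close>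

lemma balanced_eval_\<gamma>L:
  assumes "balanced (ractL t_L) (lactL s_L) h"
  shows "balanced (ractL t_L) (lactL s_L)
    (\<lambda>x y. tensor_eval (\<lambda>(u, v). h (u * x) (v * y)) (\<gamma>_L a))"
proof -
  have h: "h (x + x') y = h x y + h x' y" "h x (y + y') = h x y + h x y'"
    "h (t_L (Op l) * x) y = h x (s_L l * y)" for x x' y y' l
    using assms by (auto simp: balanced_def additive_def ractL_def lactL_def)
  have "tensor_eval (\<lambda>(u, v). h (u * (t_L (Op l) * x)) (v * y)) (\<gamma>_L a) =
    tensor_eval (\<lambda>(u, v). h (u * x) (v * (s_L l * y))) (\<gamma>_L a)" for l x y
  proof -
    have "balanced (ractL t_L) (lactL s_L) (\<lambda>u v. h (u * x) (v * y))"
      by (simp add: balanced_def additive_def h ractL_def lactL_def distrib_right mult.assoc)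
    from eval_\<gamma>L_takeuchi[OF this, of l a] show ?thesis
      by (simp add: mult.assoc)
  qed
  then show ?thesis
    unfolding balanced_def
    by (intro conjI allI additive_tensor_evalI)
      (simp_all add: additive_def h ractL_def lactL_def distrib_left)
qed

end

context right_bialgebroid
begin

lemma sR_add: "s_R (x + y) = s_R x + s_R y" and sR_mult: "s_R (x * y) = s_R x * s_R y"
  and sR_one: "s_R 1 = 1"
  and tR_add: "t_R (a + b) = t_R a + t_R b" and tR_mult: "t_R (a * b) = t_R a * t_R b"
  and tR_one: "t_R 1 = 1"
  using sR_hom tR_hom by (auto simp: ring_homomorphism_def additive_def)

lemma tR_Op_add: "t_R (Op (x + y)) = t_R (Op x) + t_R (Op y)"
  using tR_add[of "Op x" "Op y"] by (simp add: opposite_simps)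

lemma tR_Op_mult: "t_R (Op (x * y)) = t_R (Op y) * t_R (Op x)"
  using tR_mult[of "Op y" "Op x"] by (simp add: opposite_simps)

lemma tR_Op_one: "t_R (Op 1) = 1"
  using tR_one by (simp add: one_opposite_def)

lemma \<pi>R_ractR: "\<pi>_R (a * s_R r) = \<pi>_R a * r"
  using \<pi>R_bimodule[of a r 1] by (simp add: tR_Op_one)

lemma eval_\<gamma>R_takeuchi:
  assumes "balanced (ractR s_R) (lactR t_R) h"
  shows "tensor_eval (\<lambda>(x, y). h (s_R r * x) y) (\<gamma>_R a) =
    tensor_eval (\<lambda>(x, y). h x (t_R (Op r) * y)) (\<gamma>_R a)"
  using arg_cong[OF \<gamma>R_takeuchi, of "tensor_eval (\<lambda>(x, y). h x y)" r a]
    compatible_tensor_rel[OF assms]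
  by (simp add: tensor_eval_map relR_def split_def)

lemma eval_\<gamma>R_mult:
  assumes "balanced (ractR s_R) (lactR t_R) h"
  shows "tensor_eval (\<lambda>(x, y). h x y) (\<gamma>_R (a * b)) =
    tensor_eval (\<lambda>(x, y). tensor_eval (\<lambda>(u, v). h (x * u) (y * v)) (\<gamma>_R b)) (\<gamma>_R a)"
  using compatible_tensor_rel[OF assms] unfolding \<gamma>R_mult relR_def
  by (simp add: tensor_eval_mult)

text \<open>The element \<open>t_R (Op r)\<close> is \<open>r\<close> acting on 1, so bimodule
  linearity and unitality of \<open>\<gamma>_R\<close> give
  \<open>t_R (Op r) \<otimes> 1\<close>.\<close>

lemma eval_\<gamma>R_tR:
  assumes "balanced (ractR s_R) (lactR t_R) h"
  shows "tensor_eval (\<lambda>(x, y). h x y) (\<gamma>_R (t_R (Op r))) = h (t_R (Op r)) 1"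
proof -
  have h: "compatible (relR s_R t_R) (\<lambda>(x, y). h x y)"
    using compatible_tensor_rel[OF assms] by (simp add: relR_def)
  \<comment> \<open>The extra factor preserves balancedness because the images of \<open>s_R\<close>
    and \<open>t_R\<close> commute.\<close>
  have h': "compatible (relR s_R t_R) (\<lambda>(x, y). h (x * t_R (Op r)) y)"
    unfolding relR_def
  proof (rule compatible_tensor_rel)
    show "balanced (ractR s_R) (lactR t_R) (\<lambda>x. h (x * t_R (Op r)))"
      using assms sR_tR_commute
      by (simp add: balanced_def additive_def ractR_def distrib_right mult.assoc)
        (simp flip: mult.assoc)
  qed
  have "tensor_eval (\<lambda>(x, y). h x y) (\<gamma>_R (1 * s_R 1 * t_R (Op r))) =
    tensor_eval (\<lambda>(x, y). h (x * t_R (Op r)) y) (\<gamma>_R 1)"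
    unfolding \<gamma>R_bimodule tensor_eval_map[OF h] by (simp add: split_def sR_one)
  also have "\<dots> = h (t_R (Op r)) 1"
    unfolding \<gamma>R_one tensor_eval_class[OF h'] by simp
  finally show ?thesis by (simp add: sR_one)
qed

text \<open>Multiplicativity reduces this to \<open>eval_\<gamma>R_tR\<close> for the map that first
  multiplies by \<open>\<gamma>_R a\<close> from the right; the Takeuchi condition makes that map
  balanced.\<close>

lemma eval_\<gamma>R_tR_left:
  assumes h: "balanced (ractR s_R) (lactR t_R) h"
  shows "tensor_eval (\<lambda>(x, y). h x y) (\<gamma>_R (t_R (Op r) * a)) =
    tensor_eval (\<lambda>(x, y). h (t_R (Op r) * x) y) (\<gamma>_R a)"
proof -
  have hs: "h (x + x') y = h x y + h x' y" "h x (y + y') = h x y + h x y'"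
    "h (x * s_R r) y = h x (y * t_R (Op r))" for x x' y y' r
    using assms by (auto simp: balanced_def additive_def ractR_def lactR_def)
  have "tensor_eval (\<lambda>(u, v). h (x * s_R r * u) (y * v)) (\<gamma>_R a) =
    tensor_eval (\<lambda>(u, v). h (x * u) (y * t_R (Op r) * v)) (\<gamma>_R a)" for r x y
  proof -
    have "balanced (ractR s_R) (lactR t_R) (\<lambda>u v. h (x * u) (y * v))"
      by (simp add: balanced_def additive_def hs ractR_def lactR_def distrib_left flip: mult.assoc)
    from eval_\<gamma>R_takeuchi[OF this, of r a] show ?thesis
      by (simp add: mult.assoc)
  qed
  then have "balanced (ractR s_R) (lactR t_R)
      (\<lambda>x y. tensor_eval (\<lambda>(u, v). h (x * u) (y * v)) (\<gamma>_R a))"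
    unfolding balanced_def
    by (intro conjI allI additive_tensor_evalI)
      (simp_all add: additive_def hs ractR_def lactR_def distrib_right)
  from eval_\<gamma>R_tR[OF this] show ?thesis
    unfolding eval_\<gamma>R_mult[OF h] by simp
qed

end


section \<open>The antipode\<close>

context symmetrized_hopf_algebroid
begin

lemma S_tL: "S (t_L (Op l) * a) = S a * s_L l"
  using S_L[of l a 1] by (simp add: tL_one sL_one flip: one_opposite_def)

lemma S_tR_left: "S (t_R (Op r) * a) = S a * s_R r"
  using S_R[of r a 1] by (simp add: tR_one sR_one flip: one_opposite_def)

lemma S_tR_right: "S (a * t_R (Op r)) = s_R r * S a"
  using S_R[of 1 a r] by (simp add: tR_one sR_one flip: one_opposite_def)

lemma S_plus: "S (a + b) = S a + S b"
  by (rule additive.add[OF S_add])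

lemma sL_eq_tR:
  obtains r where "s_L l = t_R (Op r)"
  using range_sL by (metis opposite.exhaust rangeI imageE)

text \<open>The axiom \<open>coassoc_LR\<close> tested against a triadditive map balanced over
  \<open>L\<close> in its first two arguments and over \<open>R\<close> in its last two.\<close>

lemma eval_coassoc_LR:
  assumes h: "\<And>y z. additive (\<lambda>x. h x y z)" "\<And>x z. additive (\<lambda>y. h x y z)"
    "\<And>x y. additive (\<lambda>z. h x y z)"
    and bal: "\<And>x y z l. h (t_L (Op l) * x) y z = h x (s_L l * y) z"
    "\<And>x y z r. h x (y * s_R r) z = h x y (z * t_R (Op r))"
  shows "tensor_eval (\<lambda>(x, z). tensor_eval (\<lambda>(u, v). h u v z) (\<gamma>_L x)) (\<gamma>_R a) =
    tensor_eval (\<lambda>(x, w). tensor_eval (\<lambda>(u, v). h x u v) (\<gamma>_R w)) (\<gamma>_L a)"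
proof -
  have "compatible (tensor3_rel (ractL t_L) (lactL s_L) (ractR s_R) (lactR t_R))
      (\<lambda>(x, y, z). h x y z)"
    by (rule compatible_tensor3_rel) (simp_all add: assms ractL_def lactL_def ractR_def lactR_def)
  from tensor_eval_comult_left[OF this, of \<gamma>_L "\<gamma>_R a"]
    tensor_eval_comult_right[OF this, of \<gamma>_R "\<gamma>_L a"]
  show ?thesis
    using coassoc_LR[of a] by simp
qed

text \<open>Expand \<open>a\<close> by the right counit law; \<open>S\<close> carries the left
  factor \<open>t_L (Op l)\<close> to the right factor \<open>s_L l\<close>.\<close>

lemma eval_S_\<pi>L: "tensor_eval (\<lambda>(x, y). S (x * b) * s_L (\<pi>_L y)) (\<gamma>_L a) = S (a * b)"
proof -
  have "tensor_eval (\<lambda>(x, y). t_L (Op (\<pi>_L y)) * x) (\<gamma>_L a) = a"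
    using \<gamma>L_counit_right[of a] by (simp add: ractL_def)
  then have "S (a * b) = S (tensor_eval (\<lambda>(x, y). t_L (Op (\<pi>_L y)) * x) (\<gamma>_L a) * b)"
    by simp
  then show ?thesis
    by (simp add: tensor_eval_mult_right additive_tensor_eval2[OF S_add] mult.assoc S_tL)
qed

lemma eval_tR_\<pi>R: "tensor_eval (\<lambda>(x, y). y * t_R (Op (\<pi>_R x))) (\<gamma>_R a) = a"
  using \<gamma>R_counit_left[of a] by (simp add: lactR_def)

text \<open>Extends \<open>antipode_left\<close> from \<open>b = 1\<close> to all \<open>b\<close>
  without antimultiplicativity, which is deduced from it. Below, lower indices denote legs of
  \<open>\<gamma>_L\<close> and upper ones legs of \<open>\<gamma>_R\<close>.\<close>

lemma eval_S_mult_shift: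
  "tensor_eval (\<lambda>(x, y). S (x * b) * y) (\<gamma>_L a) = S b * s_R (\<pi>_R a)"
proof -
  \<comment> \<open>The sum is \<open>K b 1\<close>. Keeping the second argument free allows
    \<open>b\<close> to be split as well, and \<open>K_eval\<close> then recombines the legs through
    \<open>\<gamma>_L (a * x)\<close>.\<close>
  define K where "K x y = tensor_eval (\<lambda>(p, q). S (p * x) * (q * y)) (\<gamma>_L a)" for x y
  have L: "balanced (ractL t_L) (lactL s_L) (\<lambda>x y. S x * y)"
    by (simp add: balanced_def additive_def ractL_def lactL_def S_tL S_plus algebra_simps)
  have K: "balanced (ractL t_L) (lactL s_L) K"
    unfolding K_def by (rule balanced_eval_\<gamma>L[OF L])
  have K_left: "additive (\<lambda>x. K x y)" and K_right: "additive (K x)"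
    and K_bal: "K (t_L (Op l) * x) y = K x (s_L l * y)" for x y l
    using K by (auto simp: balanced_def ractL_def lactL_def)
  note K_add = additive.add[OF K_left] additive.add[OF K_right]
  have K_eval: "tensor_eval (\<lambda>(u, v). K u (v * z)) (\<gamma>_L x) = s_R (\<pi>_R (a * x)) * z" for x z
  proof -
    have "tensor_eval (\<lambda>(u, v). K u (v * z)) (\<gamma>_L x) =
      tensor_eval (\<lambda>(p, q). tensor_eval (\<lambda>(u, v). S (p * u) * (q * v)) (\<gamma>_L x)) (\<gamma>_L a) * z"
      unfolding K_def by (subst tensor_eval_swap) (simp add: tensor_eval_mult_right mult.assoc)
    also have "\<dots> = s_R (\<pi>_R (a * x)) * z"
      unfolding eval_\<gamma>L_mult[OF L, symmetric] antipode_left ..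
    finally show ?thesis .
  qed
  have "tensor_eval (\<lambda>(x, y). S (x * b) * y) (\<gamma>_L a) = K b 1"
    by (simp add: K_def)
  also have "\<dots> = K (tensor_eval (\<lambda>(x, w). t_L (Op (\<pi>_L w)) * x) (\<gamma>_L b)) 1"
    using \<gamma>L_counit_right[of b] by (simp add: ractL_def)
  also have "\<dots> = tensor_eval (\<lambda>(x, w). K x (s_L (\<pi>_L w))) (\<gamma>_L b)"
    by (simp add: additive_tensor_eval2[OF K_left] K_bal)
  \<comment> \<open>The factor \<open>s_L (\<pi>_L w)\<close> is opened up by the antipode axiom, so
    that mixed coassociativity can regroup the three legs.\<close>
  also have "\<dots> =
      tensor_eval (\<lambda>(x, w). tensor_eval (\<lambda>(u, v). K x (u * S v)) (\<gamma>_R w)) (\<gamma>_L b)"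
    by (simp add: additive_tensor_eval2[OF K_right] flip: antipode_right)
  also have "\<dots> =
      tensor_eval (\<lambda>(x, z). tensor_eval (\<lambda>(u, v). K u (v * S z)) (\<gamma>_L x)) (\<gamma>_R b)"
    by (rule eval_coassoc_LR[symmetric])
      (simp_all add: additive_def K_add K_bal S_plus S_tR_right distrib_left distrib_right mult.assoc)
  also have "\<dots> = S (tensor_eval (\<lambda>(x, z). z * t_R (Op (\<pi>_R (s_R (\<pi>_R a) * x)))) (\<gamma>_R b))"
    by (simp add: K_eval additive_tensor_eval2[OF S_add] S_tR_right \<pi>R_sR)
  \<comment> \<open>The Takeuchi condition moves \<open>s_R (\<pi>_R a)\<close> off the first leg;
    the counit law then reassembles \<open>b\<close>.\<close>
  also have "\<dots> = S (tensor_eval (\<lambda>(x, z). t_R (Op (\<pi>_R a)) * z * t_R (Op (\<pi>_R x))) (\<gamma>_R b))"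
    by (subst eval_\<gamma>R_takeuchi)
      (simp_all add: balanced_def additive_def ractR_def lactR_def \<pi>R_ractR
        additive.add[OF \<pi>R_add] tR_Op_add tR_Op_mult distrib_left distrib_right mult.assoc)
  also have "\<dots> = S (t_R (Op (\<pi>_R a)) * b)"
    using arg_cong[OF eval_tR_\<pi>R[of b], of "\<lambda>x. t_R (Op (\<pi>_R a)) * x"]
    by (simp add: mult_tensor_eval mult.assoc)
  finally show ?thesis by (simp add: S_tR_left)
qed

text \<open>Evaluate \<open>S (a\<^sub>1 b) a\<^sub>2 S (a\<^sub>3)\<close>, with the mixed
  coproduct of \<open>a\<close>, in two ways: contracting the last two legs gives
  \<open>S (a * b)\<close>, and contracting the first two by \<open>eval_S_mult_shift\<close> gives
  \<open>S b * S a\<close>.\<close>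

lemma S_mult: "S (a * b) = S b * S a"
proof -
  have "S (a * b) =
      tensor_eval (\<lambda>(x, w). tensor_eval (\<lambda>(u, v). S (x * b) * (u * S v)) (\<gamma>_R w)) (\<gamma>_L a)"
    unfolding eval_S_\<pi>L[of b a, symmetric] antipode_right[symmetric] mult_tensor_eval ..
  also have "\<dots> =
      tensor_eval (\<lambda>(x, z). tensor_eval (\<lambda>(u, v). S (u * b) * (v * S z)) (\<gamma>_L x)) (\<gamma>_R a)"
    by (rule eval_coassoc_LR[symmetric])
      (simp_all add: additive_def S_plus S_tL S_tR_right distrib_left distrib_right mult.assoc)
  also have "\<dots> = S b * S (tensor_eval (\<lambda>(x, z). z * t_R (Op (\<pi>_R x))) (\<gamma>_R a))"
    unfolding mult.assoc[symmetric] tensor_eval_mult_right[symmetric] eval_S_mult_shift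
    by (simp add: additive_tensor_eval2[OF S_add] S_tR_right mult_tensor_eval mult.assoc)
  finally show ?thesis by (simp add: eval_tR_\<pi>R)
qed


section \<open>The Casimir property of left integrals\<close>

text \<open>With \<open>K b c\<close> as in the proof,
  \<open>K 1 a = K (S (a\<^sub>1) a\<^sub>2) a\<^sub>3\<close> by the counit and antipode laws.
  After regrouping, the last two legs are absorbed by the integral, leaving
  \<open>K (S a) 1\<close>.\<close>

lemma eval_left_integral:
  assumes i: "left_integral s_L \<pi>_L i" and "balanced (ractR s_R) (lactR t_R) h"
  shows "tensor_eval (\<lambda>(x, y). h x (a * y)) (\<gamma>_R i) =
    tensor_eval (\<lambda>(x, y). h (S a * x) y) (\<gamma>_R i)"
proof -
  have h: "h (x + x') y = h x y + h x' y" "h x (y + y') = h x y + h x y'"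
    "h (x * s_R r) y = h x (y * t_R (Op r))" for x x' y y' r
    using assms(2) by (auto simp: balanced_def additive_def ractR_def lactR_def)
  have bal: "balanced (ractR s_R) (lactR t_R) (\<lambda>x y. h (b * x) (c * y))" for b c
    by (simp add: balanced_def additive_def h ractR_def lactR_def distrib_left flip: mult.assoc)
  define K where "K b c = tensor_eval (\<lambda>(x, y). h (b * x) (c * y)) (\<gamma>_R i)" for b c
  have K_left: "additive (\<lambda>b. K b c)" and K_right: "additive (K b)" for b c
    unfolding K_def
    by (intro additive_tensor_evalI; simp add: additive_def h distrib_right)+
  have K_bal: "K (b * s_R r) c = K b (c * t_R (Op r))" for b c r
    unfolding K_def using eval_\<gamma>R_takeuchi[OF bal, of b r c i] by (simp add: mult.assoc)
  have K_int: "tensor_eval (\<lambda>(u, v). K (b * u) v) (\<gamma>_R w) = K (b * s_L (\<pi>_L w)) 1" for b w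
  proof -
    \<comment> \<open>Since \<open>s_L\<close> and \<open>t_R\<close> share their range, the
      integral property rewrites \<open>w * i\<close> as a left multiple of \<open>i\<close> by a
      value of \<open>t_R\<close>, whose effect on \<open>\<gamma>_R\<close> is known.\<close>
    obtain r where r: "s_L (\<pi>_L w) = t_R (Op r)" by (rule sL_eq_tR)
    have b: "balanced (ractR s_R) (lactR t_R) (\<lambda>x y. h (b * x) y)"
      using bal[of b 1] by simp
    have "tensor_eval (\<lambda>(u, v). K (b * u) v) (\<gamma>_R w) =
        tensor_eval (\<lambda>(x, y). h (b * x) y) (\<gamma>_R (w * i))"
      unfolding K_def eval_\<gamma>R_mult[OF b] by (simp add: mult.assoc)
    also have "w * i = t_R (Op r) * i"
      using i unfolding left_integral_def r[symmetric] by blast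
    finally show ?thesis
      unfolding eval_\<gamma>R_tR_left[OF b] by (simp add: K_def r mult.assoc)
  qed
  have "tensor_eval (\<lambda>(x, y). h x (a * y)) (\<gamma>_R i) = K 1 a"
    by (simp add: K_def)
  also have "\<dots> = K 1 (tensor_eval (\<lambda>(x, y). y * t_R (Op (\<pi>_R x))) (\<gamma>_R a))"
    by (simp add: eval_tR_\<pi>R)
  also have "\<dots> = tensor_eval (\<lambda>(x, y). K (s_R (\<pi>_R x)) y) (\<gamma>_R a)"
    by (simp add: additive_tensor_eval2[OF K_right] flip: K_bal)
  also have "\<dots> =
      tensor_eval (\<lambda>(x, z). tensor_eval (\<lambda>(u, v). K (S u * v) z) (\<gamma>_L x)) (\<gamma>_R a)"
    by (simp add: additive_tensor_eval2[OF K_left] flip: antipode_left)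
  also have "\<dots> =
      tensor_eval (\<lambda>(x, w). tensor_eval (\<lambda>(u, v). K (S x * u) v) (\<gamma>_R w)) (\<gamma>_L a)"
    by (rule eval_coassoc_LR)
      (simp_all add: additive_def additive.add[OF K_left] additive.add[OF K_right] K_bal S_plus
        S_tL distrib_left distrib_right flip: mult.assoc)
  also have "\<dots> = K (tensor_eval (\<lambda>(x, w). S x * s_L (\<pi>_L w)) (\<gamma>_L a)) 1"
    by (simp add: K_int additive_tensor_eval2[OF K_left])
  also have "\<dots> = tensor_eval (\<lambda>(x, y). h (S a * x) y) (\<gamma>_R i)"
    using eval_S_\<pi>L[of 1 a] by (simp add: K_def)
  finally show ?thesis .
qed

section \<open>Frobenius systems for the right base maps\<close>

lemma frobenius_sR_tR:
  assumes i: "left_integral s_L \<pi>_L i" and nd: "nondegenerate s_R t_R \<gamma>_R i"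
  shows "frobenius_extension s_R" "frobenius_extension t_R"
proof -
  have "1 \<in> (\<lambda>\<phi>. right_dual_action t_R \<gamma>_R \<phi> i) ` right_dual s_R"
    using nd unfolding nondegenerate_def bij_betw_def by blast
  then obtain \<phi> where \<phi>: "\<phi> \<in> right_dual s_R"
    and \<phi>1: "tensor_eval (\<lambda>(x, y). y * t_R (Op (\<phi> x))) (\<gamma>_R i) = 1"
    unfolding right_dual_action_def by force
  have "1 \<in> (\<lambda>\<phi>. left_dual_action s_R \<gamma>_R \<phi> i) ` left_dual t_R"
    using nd unfolding nondegenerate_def bij_betw_def by blast
  then obtain \<mu> where \<mu>: "\<mu> \<in> left_dual t_R"
    and \<mu>1: "tensor_eval (\<lambda>(x, y). x * s_R (\<mu> y)) (\<gamma>_R i) = 1"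
    unfolding left_dual_action_def by force
  have \<phi>_additive: "additive \<phi>" and \<phi>_sR: "\<phi> (a * s_R r) = \<phi> a * r" for a r
    using \<phi> by (auto simp: right_dual_def ractR_def)
  have \<mu>_additive: "additive \<mu>" and \<mu>_tR: "\<mu> (a * t_R (Op r)) = r * \<mu> a" for a r
    using \<mu> by (auto simp: left_dual_def lactR_def)
  note \<phi>_add = additive.add[OF \<phi>_additive] and \<mu>_add = additive.add[OF \<mu>_additive]

  \<comment> \<open>The Casimir property turns \<open>S a\<close> on the first leg into
    \<open>a\<close> on the second, where it factors out of the normalization
    \<open>\<phi>1\<close>. Dually for \<open>\<mu>_int\<close>.\<close>
  have \<phi>_int: "tensor_eval (\<lambda>(x, y). y * t_R (Op (\<phi> (S a * x)))) (\<gamma>_R i) = a" for a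
    using mult_tensor_eval[of a "\<lambda>x y. y * t_R (Op (\<phi> x))" "\<gamma>_R i"]
    by (subst eval_left_integral[OF i, symmetric])
      (simp_all add: \<phi>1 balanced_def additive_def ractR_def lactR_def \<phi>_add \<phi>_sR tR_Op_add
        tR_Op_mult distrib_left distrib_right mult.assoc)
  have \<mu>_int: "tensor_eval (\<lambda>(x, y). x * s_R (\<mu> (a * y))) (\<gamma>_R i) = S a" for a
    using mult_tensor_eval[of "S a" "\<lambda>x y. x * s_R (\<mu> y)" "\<gamma>_R i"]
    by (subst eval_left_integral[OF i])
      (simp_all add: \<mu>1 balanced_def additive_def ractR_def lactR_def \<mu>_add \<mu>_tR sR_add
        sR_mult distrib_left distrib_right mult.assoc)

  \<comment> \<open>Expand \<open>S a\<close> by \<open>\<mu>_int\<close> under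
    \<open>\<phi>\<close>, then absorb \<open>\<phi> x\<close> into the argument of
    \<open>\<mu>\<close> and contract by \<open>\<phi>1\<close>.\<close>
  have \<phi>_S: "\<phi> (S a) = \<mu> a" for a
  proof -
    have "\<phi> (S a) = tensor_eval (\<lambda>(x, y). \<phi> x * \<mu> (a * y)) (\<gamma>_R i)"
      by (simp add: additive_tensor_eval2[OF \<phi>_additive] \<phi>_sR flip: \<mu>_int)
    also have "\<dots> = \<mu> (a * tensor_eval (\<lambda>(x, y). y * t_R (Op (\<phi> x))) (\<gamma>_R i))"
      by (simp add: mult_tensor_eval additive_tensor_eval2[OF \<mu>_additive] \<mu>_tR
          flip: mult.assoc)
    finally show ?thesis by (simp add: \<phi>1)
  qed

  \<comment> \<open>Membership in the dual gives only right linearity. Left linearity follows from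
    injectivity in the non-degeneracy condition: both functionals lie in the right dual and send
    \<open>i\<close> to \<open>t_R (Op r)\<close>.\<close>
  have \<phi>_left: "\<phi> (s_R r * a) = r * \<phi> a" for r a
  proof -
    have "(\<lambda>a. \<phi> (s_R r * a)) = (\<lambda>a. r * \<phi> a)"
    proof (rule inj_onD)
      show "inj_on (\<lambda>\<phi>. right_dual_action t_R \<gamma>_R \<phi> i) (right_dual s_R)"
        using nd by (simp add: nondegenerate_def bij_betw_def)
      have "tensor_eval (\<lambda>(x, y). y * t_R (Op (\<phi> (s_R r * x)))) (\<gamma>_R i) =
          tensor_eval (\<lambda>(x, y). t_R (Op r) * y * t_R (Op (\<phi> x))) (\<gamma>_R i)"
        by (rule eval_\<gamma>R_takeuchi)
          (simp add: balanced_def additive_def ractR_def lactR_def \<phi>_add \<phi>_sR tR_Op_add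
            tR_Op_mult distrib_left distrib_right mult.assoc)
      moreover have "tensor_eval (\<lambda>(x, y). y * t_R (Op (r * \<phi> x))) (\<gamma>_R i) = t_R (Op r)"
        using tensor_eval_mult_right[of "\<lambda>x y. y * t_R (Op (\<phi> x))" "\<gamma>_R i" "t_R (Op r)"]
        by (simp add: \<phi>1 tR_Op_mult mult.assoc)
      moreover have
        "tensor_eval (\<lambda>(x, y). t_R (Op r) * y * t_R (Op (\<phi> x))) (\<gamma>_R i) = t_R (Op r)"
        using mult_tensor_eval[of "t_R (Op r)" "\<lambda>x y. y * t_R (Op (\<phi> x))" "\<gamma>_R i"]
        by (simp add: \<phi>1 mult.assoc)
      ultimately show "right_dual_action t_R \<gamma>_R (\<lambda>a. \<phi> (s_R r * a)) i =
          right_dual_action t_R \<gamma>_R (\<lambda>a. r * \<phi> a) i"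
        by (simp add: right_dual_action_def)
    qed (simp_all add: right_dual_def ractR_def additive_def \<phi>_add \<phi>_sR distrib_left
        flip: mult.assoc)
    then show ?thesis by (rule fun_cong)
  qed

  have S_inv: "S (inv S a) = a" and inv_S: "inv S (S a) = a" for a
    using S_bij by (simp_all add: bij_is_surj surj_f_inv_f bij_is_inj)
  have inv_S_additive: "additive (inv S)"
    unfolding additive_def
    by (intro allI, rule injD[OF bij_is_inj[OF S_bij]]) (simp add: S_plus S_inv)
  have inv_S_sR: "inv S (a * s_R r) = t_R (Op r) * inv S a" for a r
    by (rule injD[OF bij_is_inj[OF S_bij]]) (simp add: S_inv S_tR_left)

  show "frobenius_extension s_R"
  proof (rule frobenius_extensionI[OF sR_hom \<phi>_additive \<phi>_left \<phi>_sR])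
    fix m
    define X where "X = {#(x, S y). (x, y) \<in># tensor_rep (\<gamma>_R i)#}"
    \<comment> \<open>This is \<open>S\<close> applied to \<open>\<phi>_int\<close> at
      \<open>inv S m\<close>.\<close>
    have "(\<Sum>(u, v)\<in>#X. s_R (\<phi> (m * u)) * v) =
        S (tensor_eval (\<lambda>(x, y). y * t_R (Op (\<phi> (S (inv S m) * x)))) (\<gamma>_R i))"
      by (simp add: additive_tensor_eval2[OF S_add] S_tR_right S_inv)
        (simp add: X_def tensor_eval_def split_def image_mset.compositionality comp_def)
    also have "\<dots> = m"
      using \<phi>_int[of "inv S m"] by (simp add: S_inv)
    finally show "(\<Sum>(u, v)\<in>#X. s_R (\<phi> (m * u)) * v) = m" .
    \<comment> \<open>Antimultiplicativity rewrites \<open>S y * m\<close> as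
      \<open>S (inv S m * y)\<close>, which brings the sum to the form of
      \<open>\<mu>_int\<close>.\<close>
    have "(\<Sum>(u, v)\<in>#X. u * s_R (\<phi> (v * m))) =
        tensor_eval (\<lambda>(x, y). x * s_R (\<phi> (S (inv S m * y)))) (\<gamma>_R i)"
      by (simp add: S_mult S_inv)
        (simp add: X_def tensor_eval_def split_def image_mset.compositionality comp_def)
    also have "\<dots> = m"
      unfolding \<phi>_S \<mu>_int S_inv ..
    finally show "(\<Sum>(u, v)\<in>#X. u * s_R (\<phi> (v * m))) = m" .
  qed

  show "frobenius_extension t_R"
  proof (rule frobenius_extensionI[OF tR_hom])
    show "additive (\<lambda>a. Op (\<mu> a))"
      by (simp add: additive_def \<mu>_add opposite_simps)
    \<comment> \<open>Here \<open>\<mu> = \<phi> \<circ> S\<close> transfers the right linearity of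
      \<open>\<phi>\<close>, since \<open>S\<close> turns the left factor from \<open>t_R\<close>
      into a right factor from \<open>s_R\<close>.\<close>
    show "Op (\<mu> (t_R n * m)) = n * Op (\<mu> m)" for n m
      by (cases n) (simp add: opposite_simps S_tR_left \<phi>_sR flip: \<phi>_S)
    show "Op (\<mu> (m * t_R n)) = Op (\<mu> m) * n" for n m
      by (cases n) (simp add: opposite_simps \<mu>_tR)
    fix m
    define X where "X = {#(y, inv S x). (x, y) \<in># tensor_rep (\<gamma>_R i)#}"
    have "(\<Sum>(u, v)\<in>#X. t_R (Op (\<mu> (m * u))) * v) =
        inv S (tensor_eval (\<lambda>(x, y). x * s_R (\<mu> (m * y))) (\<gamma>_R i))"
      by (simp add: additive_tensor_eval2[OF inv_S_additive] inv_S_sR)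
        (simp add: X_def tensor_eval_def split_def image_mset.compositionality comp_def)
    also have "\<dots> = m"
      unfolding \<mu>_int inv_S ..
    finally show "(\<Sum>(u, v)\<in>#X. t_R (Op (\<mu> (m * u))) * v) = m" .
    \<comment> \<open>By antimultiplicativity
      \<open>\<mu> (inv S x * m) = \<phi> (S m * x)\<close>.\<close>
    have "(\<Sum>(u, v)\<in>#X. u * t_R (Op (\<mu> (v * m)))) =
        tensor_eval (\<lambda>(x, y). y * t_R (Op (\<phi> (S m * x)))) (\<gamma>_R i)"
      by (simp add: S_mult S_inv flip: \<phi>_S)
        (simp add: X_def tensor_eval_def split_def image_mset.compositionality comp_def
          S_mult S_inv)
    also have "\<dots> = m"
      by (rule \<phi>_int)
    finally show "(\<Sum>(u, v)\<in>#X. u * t_R (Op (\<mu> (v * m)))) = m" .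
  qed
qed

end

theorem theorem5p5:
  fixes s_L :: "'l::{ring,monoid_mult} \<Rightarrow> 'a::{ring,monoid_mult}"
    and t_L :: "'l opposite \<Rightarrow> 'a"
    and \<gamma>_L :: "'a \<Rightarrow> ('a \<times> 'a) multiset set"
    and \<pi>_L :: "'a \<Rightarrow> 'l"
    and s_R :: "'r::{ring,monoid_mult} \<Rightarrow> 'a"
    and t_R :: "'r opposite \<Rightarrow> 'a"
    and \<gamma>_R :: "'a \<Rightarrow> ('a \<times> 'a) multiset set"
    and \<pi>_R :: "'a \<Rightarrow> 'r"
    and S :: "'a \<Rightarrow> 'a"
  assumes "symmetrized_hopf_algebroid s_L t_L \<gamma>_L \<pi>_L s_R t_R \<gamma>_R \<pi>_R S"
    and "\<exists>i. left_integral s_L \<pi>_L i \<and> nondegenerate s_R t_R \<gamma>_R i"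
  shows "frobenius_extension s_R \<and> frobenius_extension t_R \<and>
         frobenius_extension s_L \<and> frobenius_extension t_L"
proof -
  interpret symmetrized_hopf_algebroid s_L t_L \<gamma>_L \<pi>_L s_R t_R \<gamma>_R \<pi>_R S
    by (rule assms(1))
  have R: "frobenius_extension s_R" "frobenius_extension t_R"
    using assms(2) frobenius_sR_tR by blast+
  then have "frobenius_extension s_L" "frobenius_extension t_L"
    using frobenius_extension_cong_range[OF sL_hom inj_sL R(2) range_sL]
      frobenius_extension_cong_range[OF tL_hom inj_tL R(1) range_tL] by auto
  with R show ?thesis by blast
qed

end
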